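(* Let $p$ be a prime and let $G$ be an abelian $p$-group isomorphic to a direct product of $r$ nontrivial cyclic groups, $r\ge 1$. Then the number of components of $\mathcal{G}^*(G)$ is $p^{r-1}+p^{r-2}+\cdots+1$.
   Context: A $p$-group is a finite group whose order is a power of $p$. The power graph $\mathcal{G}(G)$ of a group $G$ is the simple undirected graph with vertex set $G$ in which two distinct vertices $u,v$ are adjacent if $v=u^\alpha$ or $u=v^\alpha$ for some positive integer $\alpha$. The proper power graph $\mathcal{G}^*(G)$ is obtained from $\mathcal{G}(G)$ by deleting the identity element. A component of a graph is a maximal connected subgraph. *)

theory Defs
  imports
    "HOL-Computational_Algebra.Primes"
    "HOL-Algebra.Product_Groups"
    "Graph_Theory.Digraph_Component"
begin

definition p_group :: "nat \<Rightarrow> ('a, 'b) monoid_scheme \<Rightarrow> bool" where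
  "p_group p G \<longleftrightarrow> group G \<and> finite (carrier G) \<and> (\<exists>n. order G = p ^ n)"

text \<open>As usual in \<^theory>\<open>Graph_Theory.Digraph\<close>, an undirected graph is a symmetric digraph: each
  edge is a pair of opposite arcs.\<close>

definition power_graph :: "('a, 'b) monoid_scheme \<Rightarrow> 'a pair_pre_digraph" where
  "power_graph G =
    \<lparr> pverts = carrier G,
      parcs = {(u, v). u \<in> carrier G \<and> v \<in> carrier G \<and> u \<noteq> v \<and>
        (\<exists>k::nat. k > 0 \<and> (v = u [^]\<^bsub>G\<^esub> k \<or> u = v [^]\<^bsub>G\<^esub> k))} \<rparr>"

definition proper_power_graph :: "('a, 'b) monoid_scheme \<Rightarrow> ('a, 'a \<times> 'a) pre_digraph" where
  "proper_power_graph G = pre_digraph.del_vert (with_proj (power_graph G)) \<one>\<^bsub>G\<^esub>"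

text \<open>The qualified name distinguishes graph connectedness (which requires a nonempty vertex set)
  from the topological notion.\<close>

definition components :: "('a, 'b) pre_digraph \<Rightarrow> ('a, 'b) pre_digraph set" where
  "components \<Gamma> = {C. pre_digraph.max_subgraph \<Gamma> Digraph_Component.connected C}"

lemma graph_proper_power_graph:
  assumes "finite (carrier G)"
  shows "graph (proper_power_graph G)"
proof -
  let ?P = "proper_power_graph G"
  have verts: "verts ?P = carrier G - {\<one>\<^bsub>G\<^esub>}"
    and tail: "tail ?P = fst" and head: "head ?P = snd"
    by (simp_all add: proper_power_graph_def power_graph_def pre_digraph.del_vert_def)
  have arcs: "(u, v) \<in> arcs ?P \<longleftrightarrow> u \<in> verts ?P \<and> v \<in> verts ?P \<and> u \<noteq> v \<and>
      (\<exists>k::nat. k > 0 \<and> (v = u [^]\<^bsub>G\<^esub> k \<or> u = v [^]\<^bsub>G\<^esub> k))" for u v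
    by (auto simp only: proper_power_graph_def power_graph_def pre_digraph.del_vert_def
        with_proj_simps pair_pre_digraph.simps pre_digraph.simps mem_Collect_eq prod.case
        fst_conv snd_conv Diff_iff singleton_iff)
  have sub: "arcs ?P \<subseteq> verts ?P \<times> verts ?P"
    by (rule subrelI) (simp only: arcs mem_Times_iff fst_conv snd_conv)
  have fin: "finite (verts ?P)"
    using assms by (simp add: verts)
  have sym: "(v, u) \<in> arcs ?P" if "(u, v) \<in> arcs ?P" for u v
    using that unfolding arcs by auto
  have irrefl: "(u, u) \<notin> arcs ?P" for u
    by (simp only: arcs) simp
  have ends: "arcs_ends ?P = arcs ?P"
    by (simp add: arcs_ends_def arc_to_ends_def tail head)
  show ?thesis
  proof
    show "finite (arcs ?P)"
      using sub fin finite_subset by blast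
    show "symmetric ?P"
      unfolding symmetric_def ends sym_def using sym by blast
    fix e assume e: "e \<in> arcs ?P"
    then have "e \<in> verts ?P \<times> verts ?P"
      using sub by (rule subsetD[rotated])
    then show "tail ?P e \<in> verts ?P" "head ?P e \<in> verts ?P"
      by (simp_all only: tail head mem_Times_iff)
    show "tail ?P e \<noteq> head ?P e"
      using e irrefl by (metis head prod.collapse tail)
  next
    show "e = e'" if "arc_to_ends ?P e = arc_to_ends ?P e'" for e e'
      using that by (simp add: arc_to_ends_def tail head prod_eq_iff)
  qed (rule fin)
qed

end

theory Submission
  imports Defs "HOL-Algebra.Multiplicative_Group"
begin

text \<open>
  The components of the proper power graph of a \<open>p\<close>-group correspond to its subgroups of order \<open>p\<close>.
  Indeed, a nontrivial cyclic \<open>p\<close>-group has exactly one subgroup of order \<open>p\<close>, so to each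
  \<open>x \<noteq> 1\<close> one can attach the set \<open>S x\<close> of the \<open>p - 1\<close> elements of order \<open>p\<close> among the powers
  of \<open>x\<close> (\<open>prime_order_powers p x\<close>). If \<open>v\<close> is a power of \<open>u\<close> then \<open>S v \<subseteq> S u\<close>, and as both
  sets have \<open>p - 1\<close> elements they agree; hence \<open>S\<close> is constant on components
  (\<open>prime_order_powers_pow\<close>). Conversely, if \<open>S u = S v\<close> then any element of this nonempty set is
  a power of \<open>u\<close> and of \<open>v\<close>, and so joins \<open>u\<close> to \<open>v\<close>. There are therefore as many components as
  values of \<open>S\<close>.

  These values are disjoint, have \<open>p - 1\<close> elements each, and cover the elements of order \<open>p\<close>. So
  the number \<open>c\<close> of components of the proper power graph of any \<open>p\<close>-group satisfies
  \<open>(p - 1) c + 1 = N\<close>, where \<open>N\<close> is the number of solutions of \<open>x\<^sup>p = 1\<close>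
  (\<open>card_components_proper_power_graph\<close>). In a direct product this equation is solved
  coordinatewise, and in a nontrivial cyclic \<open>p\<close>-group it has \<open>p\<close> solutions, again because \<open>S\<close> of a
  generator has \<open>p - 1\<close> elements. Thus \<open>r\<close> factors give \<open>N = p\<^sup>r\<close>, and \<open>c\<close> is the geometric sum.
\<close>

section \<open>Elements of prime order in cyclic subgroups\<close>

context group
begin

lemma ord_eq_prime_iff:
  assumes "Factorial_Ring.prime p" "y \<in> carrier G"
  shows "ord y = p \<longleftrightarrow> y \<noteq> \<one> \<and> y [^] p = \<one>"
  unfolding pow_eq_id[OF assms(2)] ord_eq_1[OF assms(2), symmetric]
  using assms(1) by (auto simp: prime_nat_iff)

definition prime_order_powers :: "nat \<Rightarrow> 'a \<Rightarrow> 'a set" where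
  "prime_order_powers p x = {y \<in> range (\<lambda>k::nat. x [^] k). ord y = p}"

text \<open>
  All elements of order \<open>p\<close> in the cyclic group of \<open>x\<close> are powers of the single element
  \<open>w = x [^] p ^ m\<close> of order \<open>p\<close>: if \<open>(x [^] b) [^] p = 1\<close>, then \<open>p ^ (m + 1)\<close> divides \<open>b * p\<close>, so
  \<open>p ^ m\<close> divides \<open>b\<close>. The exponent of \<open>w\<close> only matters modulo \<open>p\<close>.
\<close>

lemma prime_order_powers_eq:
  assumes p: "Factorial_Ring.prime p" and x: "x \<in> carrier G" and ord_x: "ord x = p ^ Suc m"
  shows "prime_order_powers p x = (\<lambda>k. (x [^] (p ^ m)) [^] k) ` {1..<p}"
proof -
  have p0: "p > 0" using p by (rule prime_gt_0_nat)
  let ?w = "x [^] (p ^ m)"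
  have w: "?w \<in> carrier G" using x by simp
  have ord_w: "ord ?w = p"
    using ord_pow[OF x, of "p ^ m"] ord_x p0 by simp
  show ?thesis
  proof (intro equalityI subsetI)
    fix y assume "y \<in> prime_order_powers p x"
    then obtain b :: nat where y: "y = x [^] b" and ord_y: "ord y = p"
      by (auto simp: prime_order_powers_def)
    have "x [^] (b * p) = \<one>"
      using pow_ord_eq_1[of y] x unfolding ord_y by (simp add: y nat_pow_pow)
    then have "p ^ m dvd b"
      using p0 by (simp add: pow_eq_id[OF x] ord_x)
    then obtain c where b: "b = p ^ m * c" by (rule dvdE)
    have "y = ?w [^] c" using x by (simp add: y b nat_pow_pow)
    also have "\<dots> = ?w [^] (c mod p * 1 + p * (c div p))" by simp
    also have "\<dots> = ?w [^] (c mod p) \<otimes> (?w [^] p) [^] (c div p)"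
      using w by (simp only: nat_pow_mult nat_pow_pow mult_1_right)
    also have "?w [^] p = \<one>" using pow_ord_eq_1[OF w] ord_w by simp
    finally have y': "y = ?w [^] (c mod p)" using w by simp
    have "c mod p \<noteq> 0"
    proof
      assume "c mod p = 0"
      then have "ord y = 1" using y' by simp
      then show False using ord_y p by simp
    qed
    then show "y \<in> (\<lambda>k. ?w [^] k) ` {1..<p}"
      using y' p0 by (intro image_eqI[of _ _ "c mod p"]) auto
  next
    fix y assume "y \<in> (\<lambda>k. ?w [^] k) ` {1..<p}"
    then obtain k where k: "1 \<le> k" "k < p" and y: "y = ?w [^] k" by auto
    have "\<not> p dvd k" using k by (auto dest: dvd_imp_le)
    then have "y \<noteq> \<one>" by (simp add: y pow_eq_id[OF w] ord_w)
    moreover have "y [^] p = \<one>"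
      using w by (simp add: y nat_pow_pow pow_eq_id ord_w)
    ultimately have "ord y = p" using ord_eq_prime_iff[OF p] w y by simp
    moreover have "y = x [^] (p ^ m * k)" using x y by (simp add: nat_pow_pow)
    ultimately show "y \<in> prime_order_powers p x" by (auto simp: prime_order_powers_def)
  qed
qed

lemma card_prime_order_powers:
  assumes p: "Factorial_Ring.prime p" and x: "x \<in> carrier G" and ord_x: "ord x = p ^ Suc m"
  shows "card (prime_order_powers p x) = p - 1"
proof -
  have p0: "p > 0" using p by (rule prime_gt_0_nat)
  let ?w = "x [^] (p ^ m)"
  have w: "?w \<in> carrier G" using x by simp
  have "ord ?w = p"
    using ord_pow[OF x, of "p ^ m"] ord_x p0 by simp
  then have "inj_on (\<lambda>k. ?w [^] k) {0..p - 1}"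
    using ord_inj[OF w] by simp
  then have "inj_on (\<lambda>k. ?w [^] k) {1..<p}"
    by (rule inj_on_subset) auto
  then show ?thesis
    by (simp add: prime_order_powers_eq[OF assms] card_image)
qed

lemma prime_order_powers_mono:
  assumes "x \<in> carrier G"
  shows "prime_order_powers p (x [^] (k::nat)) \<subseteq> prime_order_powers p x"
  using assms by (auto simp: prime_order_powers_def nat_pow_pow)

text \<open>
  This is the invariance along the arcs of the power graph. Comparing cardinalities yields the
  reverse inclusion without having to invert exponents modulo \<open>p\<close>.
\<close>

lemma prime_order_powers_pow:
  assumes p: "Factorial_Ring.prime p" and x: "x \<in> carrier G"
    and "ord x = p ^ Suc m" "ord (x [^] k) = p ^ Suc n"
  shows "prime_order_powers p (x [^] (k::nat)) = prime_order_powers p x"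
proof (rule card_subset_eq)
  show "finite (prime_order_powers p x)"
    by (simp add: prime_order_powers_eq[OF p x assms(3)])
  show "card (prime_order_powers p (x [^] k)) = card (prime_order_powers p x)"
    using assms by (simp add: card_prime_order_powers)
qed (rule prime_order_powers_mono[OF x])

lemma ord_prime_power:
  assumes p: "Factorial_Ring.prime p" and "order G = p ^ n"
    and x: "x \<in> carrier G" "x \<noteq> \<one>"
  obtains m where "ord x = p ^ Suc m"
proof -
  have "ord x dvd p ^ n" using ord_dvd_group_order[OF x(1)] assms(2) by simp
  then obtain i where i: "ord x = p ^ i" using divides_primepow_nat[OF p] by blast
  then have "i \<noteq> 0" using x ord_eq_1 by (metis power_0)
  then show thesis using that i by (metis not0_implies_Suc)
qed

text \<open>
  Apart from the identity, the solutions are the elements of order \<open>p\<close>, and in a cyclic group every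
  element is a power of a generator.
\<close>

lemma card_pow_prime_eq_one_cyclic:
  assumes p: "Factorial_Ring.prime p" and order: "order G = p ^ n"
    and "cyclic_group G" "\<not> trivial_group G"
  shows "card {x \<in> carrier G. x [^] p = \<one>} = p"
proof -
  have fin: "finite (carrier G)"
    using order p by (metis order_gt_0_iff_finite prime_gt_0_nat zero_less_power)
  obtain g where g: "g \<in> carrier G" and gen: "subgroup_generated G {g} = G"
    using assms(3) by (auto simp: cyclic_group_def)
  have "g \<noteq> \<one>"
    using gen trivial_group_subgroup_generated[of "{g}"] assms(4) by auto
  then obtain m where m: "ord g = p ^ Suc m" using ord_prime_power[OF p order g] by blast
  have "carrier G = generate G (carrier G \<inter> {g})"
    using carrier_subgroup_generated[of G "{g}"] unfolding gen .
  also have "\<dots> = range (\<lambda>k::nat. g [^] k)"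
    using generate_pow_on_finite_carrier[OF fin g] g by auto
  finally have "carrier G = range (\<lambda>k::nat. g [^] k)" .
  then have "{x \<in> carrier G. x [^] p = \<one>} = insert \<one> (prime_order_powers p g)"
    using ord_eq_prime_iff[OF p] by (auto simp: prime_order_powers_def)
  moreover have "\<one> \<notin> prime_order_powers p g"
    using p by (auto simp: prime_order_powers_def)
  moreover have "finite (prime_order_powers p g)"
    by (simp add: prime_order_powers_eq[OF p g m])
  ultimately show ?thesis
    using prime_gt_0_nat[OF p] by (simp add: card_prime_order_powers[OF p g m])
qed

end

section \<open>Solutions of \<open>x\<^sup>p = 1\<close> in products of cyclic groups\<close>

lemma nat_pow_product_group:
  assumes "f \<in> carrier (product_group I H)"
  shows "f [^]\<^bsub>product_group I H\<^esub> (n::nat) = (\<lambda>i\<in>I. f i [^]\<^bsub>H i\<^esub> n)"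
  by (induction n) (auto simp: fun_eq_iff)

lemma card_pow_eq_one_product_group:
  assumes "finite I" "\<And>i. i \<in> I \<Longrightarrow> group (H i)"
  shows "card {f \<in> carrier (product_group I H). f [^]\<^bsub>product_group I H\<^esub> (n::nat) = \<one>\<^bsub>product_group I H\<^esub>}
    = (\<Prod>i\<in>I. card {x \<in> carrier (H i). x [^]\<^bsub>H i\<^esub> n = \<one>\<^bsub>H i\<^esub>})"
proof -
  have "{f \<in> carrier (product_group I H). f [^]\<^bsub>product_group I H\<^esub> n = \<one>\<^bsub>product_group I H\<^esub>}
    = (\<Pi>\<^sub>E i\<in>I. {x \<in> carrier (H i). x [^]\<^bsub>H i\<^esub> n = \<one>\<^bsub>H i\<^esub>})" (is "?L = ?R")
  proof (rule Set.set_eqI)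
    fix f
    show "f \<in> ?L \<longleftrightarrow> f \<in> ?R"
    proof (cases "f \<in> carrier (product_group I H)")
      case True
      then show ?thesis
        by (simp add: nat_pow_product_group[OF True] PiE_iff fun_eq_iff restrict_def) meson
    next
      case False
      then show ?thesis by (auto simp: PiE_iff)
    qed
  qed
  then show ?thesis by (simp add: card_PiE[OF assms(1)])
qed

lemma card_pow_eq_one_iso:
  assumes "group G" "group K" "G \<cong> K"
  shows "card {x \<in> carrier G. x [^]\<^bsub>G\<^esub> (n::nat) = \<one>\<^bsub>G\<^esub>} = card {x \<in> carrier K. x [^]\<^bsub>K\<^esub> n = \<one>\<^bsub>K\<^esub>}"
proof -
  interpret G: group G by fact
  interpret K: group K by fact
  obtain h where h: "h \<in> iso G K" using assms(3) by (auto simp: is_iso_def)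
  then interpret h: group_hom G K h
    by unfold_locales (simp add: iso_def)
  have bij: "bij_betw h (carrier G) (carrier K)" using h by (simp add: iso_def)
  have *: "h x [^]\<^bsub>K\<^esub> n = \<one>\<^bsub>K\<^esub> \<longleftrightarrow> x [^]\<^bsub>G\<^esub> n = \<one>\<^bsub>G\<^esub>" if "x \<in> carrier G" for x
    using that bij h.hom_nat_pow[OF that, of n] h.hom_one
    by (metis G.nat_pow_closed G.one_closed bij_betw_imp_inj_on inj_on_eq_iff)
  have "bij_betw h {x \<in> carrier G. x [^]\<^bsub>G\<^esub> n = \<one>\<^bsub>G\<^esub>} {x \<in> carrier K. x [^]\<^bsub>K\<^esub> n = \<one>\<^bsub>K\<^esub>}"
    using bij_betw_Collect[OF bij, of "\<lambda>y. y [^]\<^bsub>K\<^esub> n = \<one>\<^bsub>K\<^esub>" "\<lambda>x. x [^]\<^bsub>G\<^esub> n = \<one>\<^bsub>G\<^esub>"] * by blast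
  then show ?thesis by (rule bij_betw_same_card)
qed

text \<open>
  Each factor is itself a \<open>p\<close>-group, because the product of the orders of the factors is the order
  of \<open>G\<close>, a power of \<open>p\<close>. This also excludes infinite factors: their order is \<open>0\<close> by convention,
  which does not divide a power of \<open>p\<close>.
\<close>

lemma card_pow_prime_eq_one_product_cyclic:
  assumes p: "Factorial_Ring.prime p" and "group G" and order: "order G = p ^ n"
    and H: "\<And>i. i < r \<Longrightarrow> group (H i) \<and> cyclic_group (H i) \<and> \<not> trivial_group (H i)"
    and iso: "G \<cong> product_group {..<r} H"
  shows "card {x \<in> carrier G. x [^]\<^bsub>G\<^esub> p = \<one>\<^bsub>G\<^esub>} = p ^ r"
proof -
  have "(\<Prod>i<r. order (H i)) = p ^ n"
    using iso_same_card[OF iso] order by (simp add: order_def card_PiE)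
  then have "order (H i) dvd p ^ n" if "i < r" for i
    using that by (metis dvd_prodI finite_lessThan lessThan_iff)
  then have "card {x \<in> carrier (H i). x [^]\<^bsub>H i\<^esub> p = \<one>\<^bsub>H i\<^esub>} = p" if "i < r" for i
    using group.card_pow_prime_eq_one_cyclic[OF _ p] H that divides_primepow_nat[OF p] by metis
  then show ?thesis
    using card_pow_eq_one_iso[OF \<open>group G\<close> product_group iso]
      card_pow_eq_one_product_group[of "{..<r}" H p] H
    by simp
qed

section \<open>Components of symmetric digraphs\<close>

lemma arc_mono_connected: "arc_mono Digraph_Component.connected"
  unfolding arc_mono_def
  by (metis spanning_def subgraphE wf_digraph.connected_spanning_imp_connected)

lemma (in wf_digraph) strongly_connected_imp_connected:
  assumes "strongly_connected G"
  shows "Digraph_Component.connected G"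
  using assms by (intro connectedI) (auto simp: strongly_connected_def reachable_mk_symmetricI)

text \<open>
  A connected subgraph of a symmetric digraph need not be symmetric, hence need not be strongly
  connected, so the two notions of maximal subgraph have to be compared with care. The subgraph
  induced on its vertices is symmetric and still connected, thus strongly connected; and a maximal
  subgraph of either kind is induced.
\<close>

lemma (in sym_digraph) components_eq_sccs: "components G = sccs"
proof -
  have ind: "strongly_connected (G \<restriction> verts H)"
    if "subgraph H G" "Digraph_Component.connected H" for H
  proof -
    have i: "induced_subgraph (G \<restriction> verts H) G"
      using that by (intro induced_induce) auto
    then interpret I: wf_digraph "G \<restriction> verts H" by (rule wf_digraphI_induced)
    have "Digraph_Component.connected (G \<restriction> verts H)"
      using arc_mono_connected that subgraph_induce_subgraphI2[OF that(1)]
      unfolding arc_mono_def by (metis induce_subgraph_verts)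
    then show ?thesis
      using I.symmetric_connected_imp_strongly_connected induced_graph_imp_symmetric[OF sym_arcs i]
      by blast
  qed
  have "max_subgraph Digraph_Component.connected H \<longleftrightarrow> max_subgraph strongly_connected H" for H
  proof
    assume H: "max_subgraph Digraph_Component.connected H"
    have "G \<restriction> verts H = H"
      using induced_subgraphI_arc_mono[OF H arc_mono_connected] by (rule induce_eq_iff_induced)
    then have "strongly_connected H"
      using ind H by (metis max_subgraph_def)
    then show "max_subgraph strongly_connected H"
      using H wf_digraph.strongly_connected_imp_connected unfolding max_subgraph_def
      by (metis subgraphE)
  next
    assume H: "max_subgraph strongly_connected H"
    show "max_subgraph Digraph_Component.connected H"
    proof (rule max_subgraphI)
      show "Digraph_Component.connected H" "subgraph H G"
        using H wf_digraph.strongly_connected_imp_connected unfolding max_subgraph_def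
        by (metis subgraphE)+
      fix K assume K: "H \<noteq> K" "subgraph H K" "subgraph K G"
      show "\<not> Digraph_Component.connected K"
      proof
        assume "Digraph_Component.connected K"
        then have "strongly_connected (G \<restriction> verts K)" using ind K by blast
        moreover have KI: "subgraph K (G \<restriction> verts K)" using K by (intro subgraph_induce_subgraphI2)
        moreover have IG: "subgraph (G \<restriction> verts K) G"
          using K by (intro induced_imp_subgraph induced_induce) auto
        ultimately have "G \<restriction> verts K = H"
          using H K(2) subgraph_trans unfolding max_subgraph_def by metis
        then have "subgraph K H" using KI by simp
        then show False using K by (auto simp: subgraph_def compatible_def)
      qed
    qed
  qed
  then show ?thesis unfolding components_def sccs_altdef2 by blast
qed

text \<open>
  A component is then the fibre of a complete invariant of reachability, so components can be
  counted by the values of such an invariant.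
\<close>

lemma (in sym_digraph) card_components_eq_card_image:
  assumes arc: "\<And>u v. u \<rightarrow>\<^bsub>G\<^esub> v \<Longrightarrow> f u = f v"
    and reach: "\<And>u v. u \<in> verts G \<Longrightarrow> v \<in> verts G \<Longrightarrow> f u = f v \<Longrightarrow> u \<rightarrow>\<^sup>*\<^bsub>G\<^esub> v"
  shows "card (components G) = card (f ` verts G)"
proof -
  have inv: "f u = f v" if "u \<rightarrow>\<^sup>*\<^bsub>G\<^esub> v" for u v
    using that by (induction rule: reachable_induct) (auto simp: arc)
  have "scc_of u = {v \<in> verts G. f v = f u}" if "u \<in> verts G" for u
    using that by (auto simp: scc_of_def reachable_in_verts intro: reach dest: inv)
  then have "sccs_verts = (\<lambda>y. {v \<in> verts G. f v = y}) ` (f ` verts G)"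
    unfolding sccs_verts_conv_scc_of image_image by (intro image_cong) auto
  moreover have "inj_on (\<lambda>y. {v \<in> verts G. f v = y}) (f ` verts G)"
    by (rule inj_onI) blast
  ultimately show ?thesis
    by (simp add: components_eq_sccs card_image flip: card_sccs_verts)
qed

section \<open>The proper power graph of a \<open>p\<close>-group\<close>

lemma verts_proper_power_graph: "verts (proper_power_graph G) = carrier G - {\<one>\<^bsub>G\<^esub>}"
  by (simp add: proper_power_graph_def power_graph_def pre_digraph.del_vert_def)

lemma proper_power_graph_dominates_iff:
  "u \<rightarrow>\<^bsub>proper_power_graph G\<^esub> v \<longleftrightarrow>
    u \<in> carrier G - {\<one>\<^bsub>G\<^esub>} \<and> v \<in> carrier G - {\<one>\<^bsub>G\<^esub>} \<and> u \<noteq> v \<and>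
    (\<exists>k::nat. k > 0 \<and> (v = u [^]\<^bsub>G\<^esub> k \<or> u = v [^]\<^bsub>G\<^esub> k))"
  by (auto simp: proper_power_graph_def power_graph_def pre_digraph.del_vert_def
      arcs_ends_def arc_to_ends_def)

text \<open>
  The invariant is \<open>prime_order_powers p\<close>. Its values partition the elements of order \<open>p\<close> into sets
  of size \<open>p - 1\<close>, and the summand \<open>1\<close> accounts for the identity.
\<close>

lemma card_components_proper_power_graph:
  assumes p: "Factorial_Ring.prime p" and "p_group p G"
  shows "(p - 1) * card (components (proper_power_graph G)) + 1
    = card {x \<in> carrier G. x [^]\<^bsub>G\<^esub> p = \<one>\<^bsub>G\<^esub>}"
proof -
  interpret group G using assms(2) by (simp add: p_group_def)
  have fin: "finite (carrier G)" using assms(2) by (simp add: p_group_def)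
  obtain n where order: "order G = p ^ n" using assms(2) by (auto simp: p_group_def)
  let ?\<Gamma> = "proper_power_graph G"
  interpret \<Gamma>: graph ?\<Gamma> using fin by (rule graph_proper_power_graph)
  let ?V = "carrier G - {\<one>\<^bsub>G\<^esub>}"
  let ?S = "prime_order_powers p"
  have V_ord: "\<exists>m. ord x = p ^ Suc m" if "x \<in> ?V" for x
    using that ord_prime_power[OF p order] by blast
  have S_pow: "?S (x [^]\<^bsub>G\<^esub> k) = ?S x" if "x \<in> ?V" "x [^]\<^bsub>G\<^esub> k \<in> ?V" for x and k :: nat
    using V_ord[OF that(1)] V_ord[OF that(2)] prime_order_powers_pow[OF p] that by blast
  have card_S: "card (?S x) = p - 1" if "x \<in> ?V" for x
    using V_ord[OF that] card_prime_order_powers[OF p] that by blast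
  have S_sub: "?S x \<subseteq> ?V" if "x \<in> carrier G" for x
    using that p by (auto simp: prime_order_powers_def)
  have S_eq: "?S y = ?S x" if "x \<in> ?V" "y \<in> ?S x" for x y
    using that S_sub[of x] S_pow[of x] unfolding prime_order_powers_def by blast
  have S_self: "y \<in> ?S y" if "y \<in> carrier G" "ord y = p" for y
    using that by (auto simp: prime_order_powers_def intro: image_eqI[of _ _ "1::nat"])
  have reach: "u \<rightarrow>\<^sup>*\<^bsub>?\<Gamma>\<^esub> y" if u: "u \<in> ?V" and yu: "y \<in> ?S u" for u y
  proof (cases "u = y")
    case True
    then show ?thesis using u by (auto simp: verts_proper_power_graph)
  next
    case False
    obtain k :: nat where k: "y = u [^]\<^bsub>G\<^esub> k" using yu by (auto simp: prime_order_powers_def)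
    have y: "y \<in> ?V" using S_sub u yu by blast
    then have "k > 0" using k by (auto intro: ccontr)
    then have "u \<rightarrow>\<^bsub>?\<Gamma>\<^esub> y"
      using u y k False by (auto simp: proper_power_graph_dominates_iff)
    then show ?thesis by (rule \<Gamma>.reachable_adjI)
  qed
  have "card (components ?\<Gamma>) = card (?S ` verts ?\<Gamma>)"
  proof (rule \<Gamma>.card_components_eq_card_image)
    show "?S u = ?S v" if "u \<rightarrow>\<^bsub>?\<Gamma>\<^esub> v" for u v
      using that S_pow by (auto simp: proper_power_graph_dominates_iff)
  next
    fix u v assume uv: "u \<in> verts ?\<Gamma>" "v \<in> verts ?\<Gamma>" "?S u = ?S v"
    have "card (?S u) > 0"
      using card_S uv prime_gt_1_nat[OF p] by (simp add: verts_proper_power_graph)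
    then obtain y where "y \<in> ?S u" by (metis card.empty all_not_in_conv less_irrefl)
    then have "u \<rightarrow>\<^sup>*\<^bsub>?\<Gamma>\<^esub> y" "v \<rightarrow>\<^sup>*\<^bsub>?\<Gamma>\<^esub> y"
      using reach uv by (auto simp: verts_proper_power_graph)
    then show "u \<rightarrow>\<^sup>*\<^bsub>?\<Gamma>\<^esub> v"
      using symmetric_reachable[OF \<Gamma>.sym_arcs] \<Gamma>.reachable_trans by blast
  qed
  moreover have "(p - 1) * card (?S ` ?V) = card (\<Union> (?S ` ?V))"
  proof (rule card_partition)
    show "finite (?S ` ?V)" using fin by simp
    show "finite (\<Union> (?S ` ?V))"
      using fin S_sub by (meson DiffD1 UN_least finite_Diff finite_subset)
    show "card c = p - 1" if "c \<in> ?S ` ?V" for c using that card_S by auto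
    show "c \<inter> d = {}" if "c \<in> ?S ` ?V" "d \<in> ?S ` ?V" "c \<noteq> d" for c d
      using that S_eq by blast
  qed
  moreover have "{x \<in> carrier G. x [^]\<^bsub>G\<^esub> p = \<one>\<^bsub>G\<^esub>} = insert \<one>\<^bsub>G\<^esub> (\<Union> (?S ` ?V))"
  proof -
    have "\<Union> (?S ` ?V) = {y \<in> ?V. ord y = p}"
      using S_sub S_self by (auto simp: prime_order_powers_def)
    then show ?thesis using ord_eq_prime_iff[OF p] by auto
  qed
  moreover have "\<one>\<^bsub>G\<^esub> \<notin> \<Union> (?S ` ?V)" using S_sub by blast
  moreover have "finite (\<Union> (?S ` ?V))"
    using fin S_sub by (meson DiffD1 UN_least finite_Diff finite_subset)
  ultimately show ?thesis by (simp add: verts_proper_power_graph)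
qed

theorem theorem3p3:
  fixes p r :: nat
    and G :: "('a, 'b) monoid_scheme"
    and H :: "nat \<Rightarrow> ('c, 'd) monoid_scheme"
  assumes "Factorial_Ring.prime p"
    and "comm_group G"
    and "p_group p G"
    and "r \<ge> 1"
    and "\<And>i. i < r \<Longrightarrow> group (H i) \<and> cyclic_group (H i) \<and> \<not> trivial_group (H i)"
    and "G \<cong> product_group {..<r} H"
  shows "card (components (proper_power_graph G)) = (\<Sum>i<r. p ^ i)"
proof -
  let ?c = "card (components (proper_power_graph G))"
  obtain n where "order G = p ^ n" and G: "group G"
    using assms(3) by (auto simp: p_group_def)
  then have "(p - 1) * ?c + 1 = p ^ r"
    using card_components_proper_power_graph[OF assms(1,3)]
      card_pow_prime_eq_one_product_cyclic[OF assms(1) G _ assms(5,6)] by simp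
  moreover have "(p - 1) * (\<Sum>i<r. p ^ i) + 1 = p ^ r"
  proof -
    \<comment> \<open>Writing \<open>p - 1\<close> as \<open>q\<close> avoids truncated subtraction in the induction.\<close>
    obtain q where "p = Suc q" using prime_gt_0_nat[OF assms(1)] gr0_implies_Suc by blast
    moreover have "q * (\<Sum>i<r. Suc q ^ i) + 1 = Suc q ^ r"
      by (induction r) (simp_all add: distrib_left)
    ultimately show ?thesis by simp
  qed
  ultimately have "(p - 1) * ?c = (p - 1) * (\<Sum>i<r. p ^ i)" by linarith
  then show ?thesis using prime_gt_1_nat[OF assms(1)] by simp
qed

end
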